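(* Let $K$ be the split graph with $10$ vertices obtained by combining a clique on four vertices $\{a,b,c,d\}$ with an independent set on six vertices, such that for each pair of vertices in the clique there is a unique vertex in the independent set that is adjacent exactly to both vertices of that pair. Then $K$ does not have a $2$-dot product representation.
   Context: Graphs are finite and simple. A split graph is a graph whose vertices can be partitioned into an independent set and a clique. A $2$-dot product representation of a graph $G=(V,E)$ is an assignment of vectors $\mathbf{a}^u\in\mathbb{R}^2$ ($u\in V$) together with a threshold $t>0$ such that, for all distinct $u,v\in V$, $uv\in E$ if and only if $\mathbf{a}^u\cdot\mathbf{a}^v\ge t$ (one may take $t=1$ by scaling). *)

theory Defs
  imports "HOL-Analysis.Analysis" "HOL-Library.Ramsey"
begin

text \<open>A graph is given by its vertex set and a set of two-element vertex sets.
  \<^const>\<open>clique\<close> and \<^const>\<open>indep\<close> are those of \<^theory>\<open>HOL-Library.Ramsey\<close>.\<close>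

definition simple_graph :: "'v set \<Rightarrow> 'v set set \<Rightarrow> bool" where
  "simple_graph V E \<longleftrightarrow> finite V \<and> E \<subseteq> [V]\<^bsup>2\<^esup>"

definition neighbours :: "'v set \<Rightarrow> 'v set set \<Rightarrow> 'v \<Rightarrow> 'v set" where
  "neighbours V E v = {u \<in> V. {u, v} \<in> E}"

definition split_partition :: "'v set \<Rightarrow> 'v set set \<Rightarrow> 'v set \<Rightarrow> 'v set \<Rightarrow> bool" where
  "split_partition V E C S \<longleftrightarrow> C \<union> S = V \<and> C \<inter> S = {} \<and> clique C E \<and> indep S E"

text \<open>The description determines the graph up to isomorphism: distinct pairs have distinct
  witnesses, so the six pairs in \<open>C\<close> account for all six vertices of \<open>S\<close>.\<close>

definition is_graph_K :: "'v set \<Rightarrow> 'v set set \<Rightarrow> bool" where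
  "is_graph_K V E \<longleftrightarrow> simple_graph V E \<and>
     (\<exists>C S. split_partition V E C S \<and> card C = 4 \<and> card S = 6 \<and>
        (\<forall>P \<in> [C]\<^bsup>2\<^esup>. \<exists>!x. x \<in> S \<and> neighbours V E x = P))"

definition dot_product_representation ::
    "'v set \<Rightarrow> 'v set set \<Rightarrow> ('v \<Rightarrow> real ^ 'k) \<Rightarrow> real \<Rightarrow> bool" where
  "dot_product_representation V E a t \<longleftrightarrow>
     t > 0 \<and> (\<forall>u\<in>V. \<forall>v\<in>V. u \<noteq> v \<longrightarrow> ({u, v} \<in> E \<longleftrightarrow> a u \<bullet> a v \<ge> t))"

definition has_2_dot_product_representation :: "'v set \<Rightarrow> 'v set set \<Rightarrow> bool" where
  "has_2_dot_product_representation V E \<longleftrightarrow>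
     (\<exists>(a :: 'v \<Rightarrow> real ^ 2) t. dot_product_representation V E a t)"

text \<open>A concrete model: clique vertices are the singletons over a four-element set,
  independent vertices are its two-element subsets, and adjacency between them is membership.\<close>

lemma is_graph_K_nonempty: "\<exists>(V :: nat set set) E. is_graph_K V E"
proof -
  define C where "C = (\<lambda>i::nat. {i}) ` {..<4}"
  define S where "S = [{..<4::nat}]\<^bsup>2\<^esup>"
  define E where "E = [C]\<^bsup>2\<^esup> \<union> {{{i}, P} | i P. P \<in> S \<and> i \<in> P}"
  have cC: "card C = 4" unfolding C_def by (subst card_image) auto
  have cS: "card S = 6" unfolding S_def by (simp add: card_nsets numeral_eq_Suc)
  have fin: "finite (C \<union> S)"
    using cC cS by (auto intro!: card_ge_0_finite)
  have C1: "card x = 1" if "x \<in> C" for x using that by (auto simp: C_def)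
  have S2: "card x = 2" if "x \<in> S" for x using that by (auto simp: S_def nsets_def)
  have disj: "C \<inter> S = {}" using C1 S2 by force
  have inC: "{i} \<in> C" if "P \<in> S" "i \<in> P" for i P
    using that by (auto simp: C_def S_def nsets_def)
  have sg: "simple_graph (C \<union> S) E"
    unfolding simple_graph_def
  proof
    show "E \<subseteq> [C \<union> S]\<^bsup>2\<^esup>"
      using disj inC nsets_mono[of C "C \<union> S" 2] by (fastforce simp: E_def)
  qed (rule fin)
  have cl: "clique C E" by (auto simp: clique_def E_def)
  have ind: "indep S E"
    unfolding indep_def
  proof (intro ballI impI notI)
    fix v w assume "v \<in> S" "w \<in> S" "{v, w} \<in> E"
    then show False using disj inC by (auto simp: E_def doubleton_eq_iff)
  qed
  have nb: "neighbours (C \<union> S) E x = (\<lambda>i. {i}) ` x" if x: "x \<in> S" for x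
  proof -
    have "x \<notin> C" using disj x by auto
    then have "{u, x} \<in> E \<longleftrightarrow> (\<exists>i\<in>x. u = {i})" for u
      using x inC by (auto simp: E_def doubleton_eq_iff)
    then show ?thesis using x inC by (auto simp: neighbours_def)
  qed
  have uniq: "\<exists>!x. x \<in> S \<and> neighbours (C \<union> S) E x = P" if "P \<in> [C]\<^bsup>2\<^esup>" for P
  proof -
    obtain i j where ij: "P = {{i}, {j}}" "i \<noteq> j" "i < 4" "j < 4"
      using \<open>P \<in> [C]\<^bsup>2\<^esup>\<close> by (auto elim!: nsets2_E simp: C_def)
    show ?thesis
    proof (intro ex1I conjI)
      show m: "{i, j} \<in> S" using ij by (simp add: S_def)
      show "neighbours (C \<union> S) E {i, j} = P" by (simp add: nb[OF m] ij)
      fix x assume "x \<in> S \<and> neighbours (C \<union> S) E x = P"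
      then have "(\<lambda>i. {i}) ` x = (\<lambda>i. {i}) ` {i, j}" using nb ij by auto
      then show "x = {i, j}" by (subst (asm) inj_image_eq_iff) auto
    qed
  qed
  have "is_graph_K (C \<union> S) E"
    unfolding is_graph_K_def split_partition_def
    by (intro conjI exI[of _ C] exI[of _ S] ballI refl sg cl ind cC cS disj uniq)
  then show ?thesis by (intro exI)
qed

end

theory Submission
  imports Defs
begin

text \<open>The clique vectors have pairwise positive inner products, so among any three of them one,
  say \<open>p\<close>, lies in the cone of the other two: \<open>p = \<alpha> q + \<beta> r\<close> with \<open>\<alpha>, \<beta> \<ge> 0\<close>.
  The vertex attached to \<open>{q, r}\<close> forces \<open>\<alpha> + \<beta> < 1\<close>, and the one attached to \<open>p\<close> and the
  fourth clique vertex forces \<open>\<alpha> + \<beta> \<ge> 1\<close>.\<close>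

text \<open>The 2x2 determinants \<open>?c\<close> of the pairs are the coefficients of a linear
  relation, as in Cramer's rule. It is nontrivial once \<open>?c u v\<close> is nonzero; otherwise
  \<open>u\<close> and \<open>v\<close> are parallel and already dependent.\<close>

lemma three_vectors_dependent:
  fixes u v w :: "real ^ 2"
  shows "\<exists>\<alpha> \<beta> \<gamma>. (\<alpha> \<noteq> 0 \<or> \<beta> \<noteq> 0 \<or> \<gamma> \<noteq> 0) \<and> \<alpha> *\<^sub>R u + \<beta> *\<^sub>R v + \<gamma> *\<^sub>R w = 0"
proof -
  let ?c = "\<lambda>x y :: real ^ 2. x $ 1 * y $ 2 - x $ 2 * y $ 1"
  have cross: "?c v w *\<^sub>R u + ?c w u *\<^sub>R v + ?c u v *\<^sub>R w = 0"
    by (simp add: vec_eq_iff forall_2 algebra_simps)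
  show ?thesis
  proof (cases "?c u v = 0")
    case False
    then show ?thesis using cross by blast
  next
    case True
    show ?thesis
    proof (cases "u = 0")
      case True
      then have "1 *\<^sub>R u + 0 *\<^sub>R v + 0 *\<^sub>R w = 0" by simp
      then show ?thesis by (metis zero_neq_one)
    next
      case False
      \<comment> \<open>Since \<open>v\<close> is parallel to the nonzero \<open>u\<close>, it
        equals its own projection onto the line of \<open>u\<close>; this is that equation
        multiplied by \<open>u \<bullet> u\<close>.\<close>
      have "(u \<bullet> v) *\<^sub>R u + (- (u \<bullet> u)) *\<^sub>R v + 0 *\<^sub>R w = 0"
        using \<open>?c u v = 0\<close>
        by (simp add: vec_eq_iff forall_2 inner_vec_def sum_2) algebra
      moreover have "- (u \<bullet> u) \<noteq> 0" using False by simp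
      ultimately show ?thesis by blast
    qed
  qed
qed

text \<open>By positivity of the inner products, a nontrivial relation among the vectors has
  coefficients of both signs. Up to a global sign exactly one is negative, and solving for its
  vector gives a cone combination.\<close>

lemma one_in_cone_of_others:
  fixes u v w :: "real ^ 2"
  assumes uv: "u \<bullet> v > 0" and uw: "u \<bullet> w > 0" and vw: "v \<bullet> w > 0"
  shows "\<exists>\<alpha> \<beta>. \<alpha> \<ge> 0 \<and> \<beta> \<ge> 0 \<and>
    (u = \<alpha> *\<^sub>R v + \<beta> *\<^sub>R w \<or> v = \<alpha> *\<^sub>R u + \<beta> *\<^sub>R w \<or> w = \<alpha> *\<^sub>R u + \<beta> *\<^sub>R v)"
proof -
  \<comment> \<open>Dividing by \<open>- \<alpha>\<close>, which is positive, preserves the signs of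
    the other two coefficients.\<close>
  have solve: "x = (\<beta> / - \<alpha>) *\<^sub>R y + (\<gamma> / - \<alpha>) *\<^sub>R z"
    if "\<alpha> *\<^sub>R x + \<beta> *\<^sub>R y + \<gamma> *\<^sub>R z = 0" "\<alpha> < 0" for \<alpha> \<beta> \<gamma> and x y z :: "real ^ 2"
  proof -
    have "\<alpha> * x $ i + \<beta> * y $ i + \<gamma> * z $ i = 0" for i
      using arg_cong[OF that(1), of "\<lambda>q. q $ i"] by simp
    with that(2) show ?thesis by (simp add: vec_eq_iff field_simps) (smt (verit))
  qed
  have signed: ?thesis
    if z: "\<alpha> *\<^sub>R u + \<beta> *\<^sub>R v + \<gamma> *\<^sub>R w = 0"
      and s: "\<alpha> < 0 \<and> \<beta> \<ge> 0 \<and> \<gamma> \<ge> 0 \<or> \<beta> < 0 \<and> \<alpha> \<ge> 0 \<and> \<gamma> \<ge> 0 \<or> \<gamma> < 0 \<and> \<alpha> \<ge> 0 \<and> \<beta> \<ge> 0"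
    for \<alpha> \<beta> \<gamma>
    using s
  proof (elim disjE conjE)
    assume "\<alpha> < 0" "\<beta> \<ge> 0" "\<gamma> \<ge> 0"
    moreover have "u = (\<beta> / - \<alpha>) *\<^sub>R v + (\<gamma> / - \<alpha>) *\<^sub>R w"
      by (rule solve) (use z \<open>\<alpha> < 0\<close> in auto)
    ultimately show ?thesis
      by (intro exI[of _ "\<beta> / - \<alpha>"] exI[of _ "\<gamma> / - \<alpha>"]) (simp add: divide_nonneg_neg)
  next
    assume "\<beta> < 0" "\<alpha> \<ge> 0" "\<gamma> \<ge> 0"
    moreover have "v = (\<alpha> / - \<beta>) *\<^sub>R u + (\<gamma> / - \<beta>) *\<^sub>R w"
      by (rule solve) (use z \<open>\<beta> < 0\<close> in \<open>auto simp: algebra_simps\<close>)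
    ultimately show ?thesis
      by (intro exI[of _ "\<alpha> / - \<beta>"] exI[of _ "\<gamma> / - \<beta>"]) (simp add: divide_nonneg_neg)
  next
    assume "\<gamma> < 0" "\<alpha> \<ge> 0" "\<beta> \<ge> 0"
    moreover have "w = (\<alpha> / - \<gamma>) *\<^sub>R u + (\<beta> / - \<gamma>) *\<^sub>R v"
      by (rule solve) (use z \<open>\<gamma> < 0\<close> in \<open>auto simp: algebra_simps\<close>)
    ultimately show ?thesis
      by (intro exI[of _ "\<alpha> / - \<gamma>"] exI[of _ "\<beta> / - \<gamma>"]) (simp add: divide_nonneg_neg)
  qed
  \<comment> \<open>Pairing the relation with \<open>u\<close> gives a vanishing sum of nonnegative
    terms, and each coefficient is multiplied by a positive number.\<close>
  have not_all_nonneg: "\<alpha> = 0 \<and> \<beta> = 0 \<and> \<gamma> = 0"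
    if z: "\<alpha> *\<^sub>R u + \<beta> *\<^sub>R v + \<gamma> *\<^sub>R w = 0" and nn: "\<alpha> \<ge> 0" "\<beta> \<ge> 0" "\<gamma> \<ge> 0" for \<alpha> \<beta> \<gamma>
  proof -
    have "u \<noteq> 0" using uv by auto
    have "\<alpha> * (u \<bullet> u) + \<beta> * (u \<bullet> v) + \<gamma> * (u \<bullet> w) = 0"
      using arg_cong[OF z, of "inner u"] by (simp add: inner_add_right)
    moreover have "\<alpha> * (u \<bullet> u) \<ge> 0" "\<beta> * (u \<bullet> v) \<ge> 0" "\<gamma> * (u \<bullet> w) \<ge> 0"
      using nn uv uw by auto
    ultimately have "\<alpha> * (u \<bullet> u) = 0" "\<beta> * (u \<bullet> v) = 0" "\<gamma> * (u \<bullet> w) = 0" by linarith+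
    then show ?thesis using \<open>u \<noteq> 0\<close> uv uw by auto
  qed
  obtain \<alpha> \<beta> \<gamma> where nz: "\<alpha> \<noteq> 0 \<or> \<beta> \<noteq> 0 \<or> \<gamma> \<noteq> 0"
    and z: "\<alpha> *\<^sub>R u + \<beta> *\<^sub>R v + \<gamma> *\<^sub>R w = 0"
    using three_vectors_dependent[of u v w] by blast
  have z': "(- \<alpha>) *\<^sub>R u + (- \<beta>) *\<^sub>R v + (- \<gamma>) *\<^sub>R w = 0"
    using arg_cong[OF z, of uminus] by simp
  let ?s = "\<lambda>\<alpha> \<beta> \<gamma> :: real. \<alpha> < 0 \<and> \<beta> \<ge> 0 \<and> \<gamma> \<ge> 0 \<or> \<beta> < 0 \<and> \<alpha> \<ge> 0 \<and> \<gamma> \<ge> 0 \<or> \<gamma> < 0 \<and> \<alpha> \<ge> 0 \<and> \<beta> \<ge> 0"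
  \<comment> \<open>Neither the relation nor its negation has only nonnegative coefficients, so
    among three signs one of the two has a single negative one.\<close>
  have "?s \<alpha> \<beta> \<gamma> \<or> ?s (- \<alpha>) (- \<beta>) (- \<gamma>)"
    using not_all_nonneg[OF z] not_all_nonneg[OF z'] nz by argo
  then show ?thesis using signed[OF z] signed[OF z'] by blast
qed

theorem theorem14:
  fixes V :: "'v set" and E :: "'v set set"
  assumes "is_graph_K V E"
  shows "\<not> has_2_dot_product_representation V E"
proof
  assume "has_2_dot_product_representation V E"
  then obtain a :: "'v \<Rightarrow> real ^ 2" and t where t: "t > 0"
    and rep: "\<And>u v. u \<in> V \<Longrightarrow> v \<in> V \<Longrightarrow> u \<noteq> v \<Longrightarrow> {u, v} \<in> E \<longleftrightarrow> a u \<bullet> a v \<ge> t"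
    by (auto simp: has_2_dot_product_representation_def dot_product_representation_def)
  obtain C S where CS: "C \<union> S = V" "C \<inter> S = {}" and cl: "clique C E" and card: "card C = 4"
    and pair: "\<And>P. P \<in> [C]\<^bsup>2\<^esup> \<Longrightarrow> \<exists>x\<in>S. neighbours V E x = P"
    using assms unfolding is_graph_K_def split_partition_def by metis
  \<comment> \<open>Take \<open>y\<close> to be the vector of the independent vertex attached to
    \<open>{i, j}\<close>: the line where the inner product with \<open>y\<close> equals
    \<open>t\<close> cuts off exactly these two clique vectors.\<close>
  have separating: "\<exists>y. \<forall>k\<in>C. a k \<bullet> y \<ge> t \<longleftrightarrow> k = i \<or> k = j"
    if "i \<in> C" "j \<in> C" "i \<noteq> j" for i j
  proof -
    have "{i, j} \<in> [C]\<^bsup>2\<^esup>" using that by (auto simp: nsets_def)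
    then obtain x where x: "x \<in> S" "neighbours V E x = {i, j}" using pair by blast
    have "a k \<bullet> a x \<ge> t \<longleftrightarrow> k = i \<or> k = j" if "k \<in> C" for k
    proof -
      have "k \<in> V" "x \<in> V" "k \<noteq> x" using that x(1) CS by auto
      moreover from this have "{k, x} \<in> E \<longleftrightarrow> k \<in> {i, j}"
        unfolding x(2)[symmetric] by (simp add: neighbours_def)
      ultimately show ?thesis using rep[of k x] by simp
    qed
    then show ?thesis by blast
  qed
  have not_in_cone: "a i \<noteq> \<alpha> *\<^sub>R a j + \<beta> *\<^sub>R a k"
    if ijk: "i \<in> C" "j \<in> C" "k \<in> C" "i \<noteq> j" "i \<noteq> k" "j \<noteq> k" and nn: "\<alpha> \<ge> 0" "\<beta> \<ge> 0"
    for i j k \<alpha> \<beta>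
  proof
    assume eq: "a i = \<alpha> *\<^sub>R a j + \<beta> *\<^sub>R a k"
    \<comment> \<open>A fourth clique vertex \<open>l\<close> is what allows a pair that contains
      \<open>i\<close> but avoids both \<open>j\<close> and \<open>k\<close>.\<close>
    have "card {i, j, k} < card C" using card ijk by simp
    then obtain l where l: "l \<in> C" "l \<notin> {i, j, k}"
      using card_mono[of "{i, j, k}" C] by (meson finite.emptyI finite.insertI not_le subsetI)
    obtain x where x: "\<forall>m\<in>C. a m \<bullet> x \<ge> t \<longleftrightarrow> m = j \<or> m = k"
      using separating[of j k] ijk by blast
    obtain y where y: "\<forall>m\<in>C. a m \<bullet> y \<ge> t \<longleftrightarrow> m = i \<or> m = l"
      using separating[of i l] ijk l by blast
    have "a j \<bullet> x \<ge> t" "a k \<bullet> x \<ge> t" "a i \<bullet> x < t"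
      using x ijk by (auto simp: not_le[symmetric])
    moreover have "\<alpha> * t + \<beta> * t \<le> \<alpha> * (a j \<bullet> x) + \<beta> * (a k \<bullet> x)"
      using calculation nn by (intro add_mono mult_left_mono) auto
    ultimately have "\<alpha> * t + \<beta> * t < t" by (simp add: eq inner_add_left)
    have "a j \<bullet> y < t" "a k \<bullet> y < t" "a i \<bullet> y \<ge> t"
      using y ijk l by (auto simp: not_le[symmetric])
    \<comment> \<open>Only a weak inequality holds here, as both coefficients may be 0; the strict
      one needed for the contradiction comes from \<open>x\<close>, through
      \<open>a i \<bullet> x < t\<close>.\<close>
    moreover have "\<alpha> * (a j \<bullet> y) + \<beta> * (a k \<bullet> y) \<le> \<alpha> * t + \<beta> * t"
      using calculation nn by (intro add_mono mult_left_mono) auto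
    ultimately have "t \<le> \<alpha> * t + \<beta> * t" by (simp add: eq inner_add_left)
    with \<open>\<alpha> * t + \<beta> * t < t\<close> show False by simp
  qed
  obtain T where "T \<subseteq> C" "card T = 3"
    using obtain_subset_with_card_n[of 3 C] card by auto
  then obtain p q r where pqr: "p \<in> C" "q \<in> C" "r \<in> C" "p \<noteq> q" "p \<noteq> r" "q \<noteq> r"
    by (auto simp: card_3_iff)
  have pos: "a u \<bullet> a v > 0" if "u \<in> C" "v \<in> C" "u \<noteq> v" for u v
  proof -
    have "{u, v} \<in> E" using cl that by (auto simp: clique_def)
    then have "a u \<bullet> a v \<ge> t" using rep[of u v] that CS by auto
    with t show ?thesis by simp
  qed
  obtain \<alpha> \<beta> where "\<alpha> \<ge> 0" "\<beta> \<ge> 0" "a p = \<alpha> *\<^sub>R a q + \<beta> *\<^sub>R a r \<or>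
    a q = \<alpha> *\<^sub>R a p + \<beta> *\<^sub>R a r \<or> a r = \<alpha> *\<^sub>R a p + \<beta> *\<^sub>R a q"
    using one_in_cone_of_others[of "a p" "a q" "a r"] pos pqr by blast
  \<comment> \<open>Each of the three alternatives is an instance of \<open>not_in_cone\<close> with
    \<open>p\<close>, \<open>q\<close>, \<open>r\<close> permuted.\<close>
  then show False using not_in_cone pqr by metis
qed

end
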